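(* For all $\epsilon\in(0,1)$, $\delta\in[0,1)$, all sufficiently large $T\in\mathbb N$, and any mechanism $\mathcal M$ that returns the value of the minimum cut in a multigraph with $n\ge 3$ nodes in the continual release model (where each update consists of a set of edges that are inserted or deleted), is $(\epsilon,\delta)$-differentially private, and is $(\alpha,T)$-accurate, it holds that (1) $\alpha=\Omega\left(\min\left\{\frac{T^{1/3}}{\epsilon^{2/3}\log^{2/3}(\epsilon T)},\frac{\sqrt n}{\epsilon\log n},T\right\}\right)$ if $\delta>0$ and $\delta=o(\epsilon/T)$; (2) $\alpha=\Omega\left(\min\left\{\sqrt{T/\epsilon},\frac{n}{\epsilon},T\right\}\right)$ if $\delta=0$. The same holds for any mechanism maintaining the minimum degree.
   Context: Continual release model: a stream of $T$ updates arrives one per time step and after each update the mechanism outputs a value that may depend only on the updates so far. Two update streams are neighboring if they differ in a single update. A randomized mechanism $\mathcal M$ is $(\epsilon,\delta)$-differentially private if for all neighboring streams $x,x'$ and all measurable sets $S$ of output sequences, $\Pr[\mathcal M(x)\in S]\le e^\epsilon\Pr[\mathcal M(x')\in S]+\delta$. $\mathcal M$ is $(\alpha,T)$-accurate for a function $f$ if for every input stream of length $T$, with probability at least $2/3$ the maximum absolute error between $\mathcal M$'s outputs and the true values of $f$, over all time steps, is at most $\alpha$. *)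

theory Defs
  imports "HOL-Probability.Probability" "HOL-Library.Multiset" "HOL-Library.Landau_Symbols"
begin

text \<open>Loopless undirected multigraphs on the node set \<open>{..<n}\<close>. An edge is a two-element set of
  nodes; parallel edges are recorded by multiplicity.\<close>

type_synonym edge = "nat set"
type_synonym multigraph = "edge multiset"

definition edges_on :: "nat \<Rightarrow> edge set" where
  "edges_on n = {e. e \<subseteq> {..<n} \<and> card e = 2}"

definition cut_value :: "multigraph \<Rightarrow> nat set \<Rightarrow> nat" where
  "cut_value G S = size {#e \<in># G. e \<inter> S \<noteq> {} \<and> e - S \<noteq> {}#}"

definition min_cut :: "nat \<Rightarrow> multigraph \<Rightarrow> nat" where
  "min_cut n G = Min (cut_value G ` {S. S \<noteq> {} \<and> S \<subset> {..<n}})"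

definition node_degree :: "multigraph \<Rightarrow> nat \<Rightarrow> nat" where
  "node_degree G v = size {#e \<in># G. v \<in> e#}"

definition min_degree :: "nat \<Rightarrow> multigraph \<Rightarrow> nat" where
  "min_degree n G = Min (node_degree G ` {..<n})"

text \<open>An update is a partial map: its domain is the set of updated edges, each of which has one
  copy inserted or one copy deleted.\<close>

datatype operation = Insert | Delete

type_synonym update = "edge \<rightharpoonup> operation"

definition apply_update :: "multigraph \<Rightarrow> update \<Rightarrow> multigraph" where
  "apply_update G u =
     G + mset_set {e. u e = Some Insert} - mset_set {e. u e = Some Delete}"

definition graph_after :: "update list \<Rightarrow> multigraph" where
  "graph_after us = foldl apply_update {#} us"

definition valid_update :: "nat \<Rightarrow> multigraph \<Rightarrow> update \<Rightarrow> bool" where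
  "valid_update n G u \<longleftrightarrow> dom u \<subseteq> edges_on n \<and> (\<forall>e. u e = Some Delete \<longrightarrow> e \<in># G)"

definition streams_of :: "nat \<Rightarrow> nat \<Rightarrow> update list set" where
  "streams_of n T =
     {x. length x = T \<and> (\<forall>t<T. valid_update n (graph_after (take t x)) (x ! t))}"

definition neighboring :: "update list \<Rightarrow> update list \<Rightarrow> bool" where
  "neighboring x x' \<longleftrightarrow> length x = length x' \<and>
     (\<exists>i<length x. x ! i \<noteq> x' ! i \<and> (\<forall>j<length x. j \<noteq> i \<longrightarrow> x ! j = x' ! j))"

text \<open>A mechanism maps a stream to the distribution of its output sequence; the output with index
  \<open>t\<close> is the one released after the update \<open>x ! t\<close>.\<close>

abbreviation output_space :: "nat \<Rightarrow> (nat \<Rightarrow> real) measure" where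
  "output_space T \<equiv> PiM {..<T} (\<lambda>_. borel)"

text \<open>The last conjunct is the online requirement: the joint law of the first \<open>t\<close> outputs is
  determined by the first \<open>t\<close> updates.\<close>

definition continual_mechanism ::
  "nat \<Rightarrow> nat \<Rightarrow> (update list \<Rightarrow> (nat \<Rightarrow> real) measure) \<Rightarrow> bool" where
  "continual_mechanism n T M \<longleftrightarrow>
     (\<forall>x\<in>streams_of n T. prob_space (M x) \<and> sets (M x) = sets (output_space T)) \<and>
     (\<forall>x\<in>streams_of n T. \<forall>x'\<in>streams_of n T. \<forall>t\<le>T. take t x = take t x' \<longrightarrow>
        distr (M x) (output_space t) (\<lambda>y. restrict y {..<t}) =
        distr (M x') (output_space t) (\<lambda>y. restrict y {..<t}))"

definition differentially_private ::
  "nat \<Rightarrow> nat \<Rightarrow> real \<Rightarrow> real \<Rightarrow> (update list \<Rightarrow> (nat \<Rightarrow> real) measure) \<Rightarrow> bool" where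
  "differentially_private n T \<epsilon> \<delta> M \<longleftrightarrow>
     (\<forall>x\<in>streams_of n T. \<forall>x'\<in>streams_of n T. neighboring x x' \<longrightarrow>
        (\<forall>S\<in>sets (output_space T). measure (M x) S \<le> exp \<epsilon> * measure (M x') S + \<delta>))"

definition accurate ::
  "nat \<Rightarrow> nat \<Rightarrow> real \<Rightarrow> (multigraph \<Rightarrow> nat) \<Rightarrow>
     (update list \<Rightarrow> (nat \<Rightarrow> real) measure) \<Rightarrow> bool" where
  "accurate n T \<alpha> f M \<longleftrightarrow>
     (\<forall>x\<in>streams_of n T.
        measure (M x) {y \<in> space (M x).
          \<forall>t<T. \<bar>y t - real (f (graph_after (take (Suc t) x)))\<bar> \<le> \<alpha>} \<ge> 2 / 3)"

end

theory Submission
  imports Defs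
begin

text \<open>The bound \<open>\<alpha> \<ge> n / (6 \<epsilon>)\<close> holds for large \<open>T\<close>, and it dominates both minima. One update may insert
  the whole complete graph and so raise minimum cut and minimum degree by \<open>n - 1\<close>. With
  \<open>k = \<lfloor>1 / \<epsilon>\<rfloor>\<close>, consider seven streams, the \<open>j\<close>-th of which inserts a complete graph at each step of
  the \<open>j\<close>-th block of \<open>k\<close> consecutive steps and does nothing otherwise. If \<open>\<alpha> < k (n - 1) / 2\<close>, the
  sets of accurate outputs of these streams are pairwise disjoint. Every stream is \<open>k\<close> changes away
  from the empty stream, so by group privacy each of these sets has probability at least
  \<open>1 / 6\<close> under the empty stream, a contradiction.\<close>

section \<open>Cuts and degrees of multiples of the complete graph\<close>

lemma finite_edges_on: "finite (edges_on n)"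
  by (rule finite_subset[of _ "Pow {..<n}"]) (auto simp: edges_on_def)

lemma doubleton_in_edges_on: "u < n \<Longrightarrow> v < n \<Longrightarrow> u \<noteq> v \<Longrightarrow> {u, v} \<in> edges_on n"
  by (auto simp: edges_on_def)

lemma size_filter_repeat_mset:
  "size (filter_mset P (repeat_mset c A)) = c * size (filter_mset P A)"
  by (induction c) auto

text \<open>Each node except a fixed \<open>s\<close> in \<open>S\<close> owns a crossing edge:
  nodes of \<open>S\<close> are joined to a fixed \<open>v\<close> outside, the others to
  \<open>s\<close>. Leaving out \<open>s\<close> keeps the map injective, since \<open>s\<close> and
  \<open>v\<close> would both yield \<open>{s, v}\<close>.\<close>

lemma card_crossing_edges_ge:
  assumes "S \<noteq> {}" "S \<subset> {..<n}"
  shows "n - 1 \<le> card {e \<in> edges_on n. e \<inter> S \<noteq> {} \<and> e - S \<noteq> {}}" (is "_ \<le> card ?C")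
proof -
  obtain s v where s: "s \<in> S" "s < n" and v: "v \<notin> S" "v < n"
    using assms by blast
  define g where "g u = (if u \<in> S then {v, u} else {s, u})" for u
  have "inj_on g ({..<n} - {s})"
    using s v by (auto simp: inj_on_def g_def doubleton_eq_iff split: if_splits)
  moreover have "g ` ({..<n} - {s}) \<subseteq> ?C"
  proof
    fix e assume "e \<in> g ` ({..<n} - {s})"
    then obtain u where "u < n" "u \<noteq> s" "e = g u"
      by auto
    moreover have "u \<noteq> v" if "u \<in> S"
      using that v by auto
    ultimately show "e \<in> ?C"
      using s v by (auto simp: g_def intro!: doubleton_in_edges_on)
  qed
  moreover have "finite ?C"
    using finite_edges_on by simp
  ultimately have "card ({..<n} - {s}) \<le> card ?C"
    by (rule card_inj_on_le)
  with s show ?thesis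
    by simp
qed

lemma cut_value_repeat_complete_ge:
  assumes "S \<noteq> {}" "S \<subset> {..<n}"
  shows "c * (n - 1) \<le> cut_value (repeat_mset c (mset_set (edges_on n))) S"
  using card_crossing_edges_ge[OF assms] finite_edges_on[of n]
  by (simp add: cut_value_def size_filter_repeat_mset filter_mset_mset_set)

lemma singleton_psubset_lessThan:
  fixes n :: nat
  assumes "n \<ge> 2" "v < n"
  shows "{v} \<subset> {..<n}"
proof -
  have "card {v} \<noteq> card {..<n}"
    using assms by simp
  then have "{v} \<noteq> {..<n}"
    by metis
  with assms show ?thesis
    by (simp add: psubset_eq)
qed

text \<open>Transfers cut bounds to degrees. Equality can fail for an arbitrary \<open>G\<close>,
  which may contain \<open>{v}\<close>: this adds to the degree but crosses no cut.\<close>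

lemma cut_value_singleton_le_node_degree: "cut_value G {v} \<le> node_degree G v"
  unfolding cut_value_def node_degree_def
  by (intro size_mset_mono filter_mset_mono_strong) auto

lemma min_cut_or_degree_repeat_complete_ge:
  assumes n: "n \<ge> 2" and f: "f \<in> {min_cut n, min_degree n}"
  shows "c * (n - 1) \<le> f (repeat_mset c (mset_set (edges_on n)))"
proof -
  let ?G = "repeat_mset c (mset_set (edges_on n))"
  have fin: "finite {S. S \<noteq> {} \<and> S \<subset> {..<n}}"
    by (rule finite_subset[of _ "Pow {..<n}"]) auto
  \<comment> \<open>This witness supplies the nonemptiness that \<open>Min_ge_iff\<close> asks
    for.\<close>
  have "{0} \<in> {S. S \<noteq> {} \<and> S \<subset> {..<n}}"
    using singleton_psubset_lessThan[of n 0] n by simp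
  then have "c * (n - 1) \<le> min_cut n ?G"
    unfolding min_cut_def using fin cut_value_repeat_complete_ge[of _ n c]
    by (subst Min_ge_iff) auto
  moreover have "c * (n - 1) \<le> min_degree n ?G"
    unfolding min_degree_def
  proof (subst Min_ge_iff)
    show "node_degree ?G ` {..<n} \<noteq> {}" using n by (auto simp: lessThan_empty_iff)
    show "\<forall>d\<in>node_degree ?G ` {..<n}. c * (n - 1) \<le> d"
    proof safe
      fix v assume "v < n"
      then have "c * (n - 1) \<le> cut_value ?G {v}"
        using n by (intro cut_value_repeat_complete_ge singleton_psubset_lessThan) auto
      also have "\<dots> \<le> node_degree ?G v"
        by (rule cut_value_singleton_le_node_degree)
      finally show "c * (n - 1) \<le> node_degree ?G v" .
    qed
  qed simp
  ultimately show ?thesis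
    using f by auto
qed

text \<open>All cuts and degrees vanish, and \<open>n \<ge> 2\<close> makes both index families
  nonempty, so that each image is exactly \<open>{0}\<close>.\<close>

lemma min_cut_or_degree_empty:
  assumes n: "n \<ge> 2" and f: "f \<in> {min_cut n, min_degree n}"
  shows "f {#} = 0"
proof -
  have "{0} \<subset> {..<n}"
    using n by (intro singleton_psubset_lessThan) auto
  then have "(\<lambda>S. 0 :: nat) ` {S. S \<noteq> {} \<and> S \<subset> {..<n}} = {0}"
    "(\<lambda>v. 0 :: nat) ` {..<n} = {0}"
    by blast+
  then have "min_cut n {#} = 0" "min_degree n {#} = 0"
    by (simp_all add: min_cut_def min_degree_def cut_value_def[abs_def] node_degree_def[abs_def])
  with f show ?thesis
    by auto
qed

section \<open>Streams that insert complete graphs\<close>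

definition insert_all :: "nat \<Rightarrow> update" where
  "insert_all n = (\<lambda>e. if e \<in> edges_on n then Some Insert else None)"

text \<open>Allowing any set \<open>A\<close> of times, not just a block, lets group privacy remove
  the pulses one at a time.\<close>

definition pulse_stream :: "nat \<Rightarrow> nat \<Rightarrow> nat set \<Rightarrow> update list" where
  "pulse_stream n T A = map (\<lambda>t. if t \<in> A then insert_all n else Map.empty) [0..<T]"

text \<open>Needed because \<open>neighboring\<close> demands different updates at the changed
  step.\<close>

lemma insert_all_neq_empty:
  assumes "n \<ge> 2"
  shows "insert_all n \<noteq> Map.empty"
proof -
  have "{0, 1} \<in> edges_on n"
    using assms by (intro doubleton_in_edges_on) auto
  then show ?thesis
    by (auto simp: insert_all_def fun_eq_iff)
qed

text \<open>Nothing is ever deleted, so only the number of earlier pulses matters.\<close>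

lemma graph_after_pulse_stream:
  assumes "t \<le> T"
  shows "graph_after (take t (pulse_stream n T A)) =
    repeat_mset (card (A \<inter> {..<t})) (mset_set (edges_on n))"
  using assms
proof (induction t)
  case 0
  then show ?case by (simp add: graph_after_def)
next
  case (Suc t)
  have "take (Suc t) (pulse_stream n T A) =
      take t (pulse_stream n T A) @ [if t \<in> A then insert_all n else Map.empty]"
    using Suc.prems by (simp add: pulse_stream_def take_Suc_conv_app_nth)
  moreover have "card (A \<inter> {..<Suc t}) = card (A \<inter> {..<t}) + (if t \<in> A then 1 else 0)"
    by (auto simp: lessThan_Suc)
  ultimately show ?case
    using Suc by (simp add: graph_after_def apply_update_def insert_all_def)
qed

lemma pulse_stream_in_streams_of: "pulse_stream n T A \<in> streams_of n T"
  by (auto simp: streams_of_def pulse_stream_def valid_update_def insert_all_def split: if_splits)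

lemma neighboring_pulse_stream_insert:
  assumes "n \<ge> 2" "a < T" "a \<notin> A"
  shows "neighboring (pulse_stream n T (insert a A)) (pulse_stream n T A)"
  using assms insert_all_neq_empty[of n]
  by (auto simp: neighboring_def pulse_stream_def intro!: exI[of _ a])

text \<open>Induction on \<open>A\<close>, dropping one pulse per step. The additive term is coarser
  than the geometric sum that the steps produce, which keeps the induction simple.\<close>

lemma group_privacy_pulse_stream:
  fixes \<epsilon> \<delta> :: real
  assumes priv: "differentially_private n T \<epsilon> \<delta> M"
    and "n \<ge> 2" "0 \<le> \<epsilon>" "0 \<le> \<delta>"
    and S: "S \<in> sets (output_space T)"
    and A: "finite A" "A \<subseteq> {..<T}"
  shows "measure (M (pulse_stream n T A)) S \<le>
    exp (card A * \<epsilon>) * (measure (M (pulse_stream n T {})) S + card A * \<delta>)"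
  using A
proof (induction A)
  case empty
  then show ?case by simp
next
  case (insert a A)
  let ?p = "measure (M (pulse_stream n T {})) S"
  have "measure (M (pulse_stream n T (insert a A))) S \<le>
      exp \<epsilon> * measure (M (pulse_stream n T A)) S + \<delta>"
    using priv S insert neighboring_pulse_stream_insert[of n a T A] \<open>n \<ge> 2\<close>
      pulse_stream_in_streams_of by (auto simp: differentially_private_def)
  \<comment> \<open>The new \<open>\<delta>\<close> is inflated by a factor that is at least 1, so
    that a common exponential factors out next.\<close>
  also have "\<dots> \<le> exp \<epsilon> * (exp (card A * \<epsilon>) * (?p + card A * \<delta>)) + exp ((1 + card A) * \<epsilon>) * \<delta>"
    using insert \<open>0 \<le> \<epsilon>\<close> \<open>0 \<le> \<delta>\<close>
    by (intro add_mono mult_left_mono) (auto simp: mult_le_cancel_right1)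
  also have "\<dots> = exp (card (insert a A) * \<epsilon>) * (?p + card (insert a A) * \<delta>)"
    using insert by (simp add: algebra_simps exp_add)
  finally show ?case .
qed

section \<open>Packing\<close>

text \<open>Privacy speaks of measurable events only; an accuracy event is a finite intersection of
  coordinate conditions.\<close>

lemma accurate_outputs_in_sets:
  "{y \<in> space (output_space T). \<forall>t<T. \<bar>y t - v t\<bar> \<le> \<alpha>} \<in> sets (output_space T)"
proof -
  have "{y \<in> space (output_space T). \<forall>t\<in>{..<T}. \<bar>y t - v t\<bar> \<le> \<alpha>} \<in> sets (output_space T)"
    by (intro sets.sets_Collect_finite_All borel_measurable_le borel_measurable_abs
        borel_measurable_diff borel_measurable_const measurable_component_singleton) auto
  then show ?thesis
    by (simp add: Ball_def)
qed

text \<open>The bound on \<open>T\<close> makes room for seven blocks of length at most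
  \<open>1 / \<epsilon>\<close>; the bound on \<open>\<delta>\<close> keeps the additive privacy
  loss over one block below \<open>1 / 18\<close>.\<close>

lemma error_lower_bound:
  fixes \<epsilon> \<delta> \<alpha> :: real
  assumes mech: "continual_mechanism n T M"
    and priv: "differentially_private n T \<epsilon> \<delta> M"
    and acc: "accurate n T \<alpha> f M"
    and n: "n \<ge> 3" and f: "f \<in> {min_cut n, min_degree n}"
    and \<epsilon>: "0 < \<epsilon>" "\<epsilon> < 1" and \<delta>: "0 \<le> \<delta>" "\<delta> \<le> \<epsilon> / 18"
    and T: "T \<ge> 7 / \<epsilon>"
  shows "\<alpha> \<ge> n / (6 * \<epsilon>)"
proof -
  \<comment> \<open>The largest group size with \<open>k * \<epsilon> \<le> 1\<close>, so that group
    privacy costs a factor of at most \<open>exp 1\<close>.\<close>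
  define k where "k = nat \<lfloor>1 / \<epsilon>\<rfloor>"
  have "1 < 1 / \<epsilon>"
    using \<epsilon> by simp
  then have k_le: "real k \<le> 1 / \<epsilon>" and k_gt: "1 / \<epsilon> < real k + 1"
    unfolding k_def by linarith+
  have "k \<ge> 1"
    using \<open>1 < 1 / \<epsilon>\<close> k_gt by linarith
  have k\<epsilon>: "k * \<epsilon> \<le> 1"
    using k_le \<epsilon> by (simp add: field_simps)
  have "real (7 * k) \<le> real T"
    using k_le T by simp
  then have T7: "7 * k \<le> T"
    by linarith
  define block where "block j = {j * k..<Suc j * k}" for j
  define x where "x j = pulse_stream n T (block j)" for j
  \<comment> \<open>Formed in the common output space, so that it can be measured both under
    \<open>M (x j)\<close> and under \<open>M0\<close>.\<close>
  define good where "good j = {y \<in> space (output_space T).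
      \<forall>t<T. \<bar>y t - real (f (graph_after (take (Suc t) (x j))))\<bar> \<le> \<alpha>}" for j
  define M0 where "M0 = M (pulse_stream n T {})"
  have block_T: "block j \<subseteq> {..<T}" if "j < 7" for j
  proof -
    have "Suc j * k \<le> 7 * k"
      using that by (intro mult_right_mono) auto
    then have "Suc j * k \<le> T"
      using T7 by (rule order_trans)
    then show ?thesis
      by (auto simp: block_def simp del: mult_Suc)
  qed
  have sets_M: "sets (M (pulse_stream n T A)) = sets (output_space T)"
    and prob_M: "prob_space (M (pulse_stream n T A))" for A
    using mech pulse_stream_in_streams_of by (auto simp: continual_mechanism_def)
  have good_sets: "good j \<in> sets (output_space T)" for j
    unfolding good_def by (rule accurate_outputs_in_sets)
  have prob_good: "measure M0 (good j) \<ge> 1 / 6" if "j < 7" for j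
  proof -
    have "space (M (x j)) = space (output_space T)"
      unfolding x_def by (rule sets_eq_imp_space_eq[OF sets_M])
    then have "2 / 3 \<le> measure (M (x j)) (good j)"
      using acc[unfolded accurate_def, THEN bspec, OF pulse_stream_in_streams_of, of "block j"]
      by (simp only: good_def x_def)
    also have "\<dots> \<le> exp (k * \<epsilon>) * (measure M0 (good j) + k * \<delta>)"
      using group_privacy_pulse_stream[OF priv _ _ _ good_sets _ block_T[OF that]] n \<epsilon> \<delta>
      by (simp add: x_def M0_def block_def)
    \<comment> \<open>Solving for the probability gives
      \<open>2 / 9 - 1 / 18 = 1 / 6\<close>.\<close>
    also have "\<dots> \<le> 3 * (measure M0 (good j) + 1 / 18)"
    proof (intro mult_mono add_left_mono)
      show "exp (k * \<epsilon>) \<le> 3"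
        using k\<epsilon> exp_le by (meson exp_le_cancel_iff order_trans)
      have "k * \<delta> \<le> k * (\<epsilon> / 18)"
        using \<delta> by (intro mult_left_mono) auto
      with k\<epsilon> show "k * \<delta> \<le> 1 / 18"
        by simp
    qed (use \<delta> in auto)
    finally show ?thesis
      by simp
  qed
  have "k * (real n - 1) \<le> 2 * \<alpha>"
  proof (rule ccontr)
    assume small: "\<not> k * (real n - 1) \<le> 2 * \<alpha>"
    have disj: "good i \<inter> good j = {}" if "i < j" "j < 7" for i j
    proof (rule ccontr)
      assume "good i \<inter> good j \<noteq> {}"
      then obtain y where y: "y \<in> good i" "y \<in> good j"
        by blast
      \<comment> \<open>At the end of block \<open>i\<close> the values of \<open>f\<close> on the two streams are \<open>k (n - 1)\<close> and \<open>0\<close>.\<close>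
      define t where "t = Suc i * k - 1"
      \<comment> \<open>Output \<open>t\<close> is compared with the graph after
        \<open>Suc t\<close> updates, hence the shift; \<open>k \<ge> 1\<close> makes the truncated
        subtraction exact.\<close>
      have Suc_t: "Suc t = Suc i * k"
        using \<open>k \<ge> 1\<close> by (simp add: t_def)
      have "Suc i * k \<le> 7 * k"
        using that by (intro mult_right_mono) auto
      then have "Suc t \<le> T"
        unfolding Suc_t using T7 by (rule order_trans)
      have "Suc i * k \<le> j * k"
        using that by (intro mult_right_mono) auto
      then have block_j: "block j \<inter> {..<Suc t} = {}"
        by (fastforce simp: Suc_t block_def)
      have block_i: "block i \<inter> {..<Suc t} = block i"
        by (auto simp: Suc_t block_def)
      have "graph_after (take (Suc t) (x i)) = repeat_mset k (mset_set (edges_on n))"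
        unfolding x_def graph_after_pulse_stream[OF \<open>Suc t \<le> T\<close>] block_i by (simp add: block_def)
      then have "k * (n - 1) \<le> f (graph_after (take (Suc t) (x i)))"
        using min_cut_or_degree_repeat_complete_ge[OF _ f] n by simp
      then have "real (k * (n - 1)) \<le> real (f (graph_after (take (Suc t) (x i))))"
        by (rule of_nat_mono)
      moreover have "f (graph_after (take (Suc t) (x j))) = 0"
        unfolding x_def graph_after_pulse_stream[OF \<open>Suc t \<le> T\<close>] block_j
        using min_cut_or_degree_empty[OF _ f] n by simp
      moreover have "\<bar>y t - real (f (graph_after (take (Suc t) (x l))))\<bar> \<le> \<alpha>" if "y \<in> good l" for l
        using that \<open>Suc t \<le> T\<close> by (auto simp: good_def)
      from this[OF y(1)] this[OF y(2)]
      have "\<bar>y t - real (f (graph_after (take (Suc t) (x i))))\<bar> \<le> \<alpha>"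
        "\<bar>y t - real (f (graph_after (take (Suc t) (x j))))\<bar> \<le> \<alpha>" .
      ultimately have "real (k * (n - 1)) \<le> 2 * \<alpha>"
        by linarith
      with small n show False
        by (simp add: of_nat_diff)
    qed
    interpret prob_space M0
      unfolding M0_def by (rule prob_M)
    have "disjoint_family_on good {..<7}"
      unfolding disjoint_family_on_def using disj by (metis Int_commute lessThan_iff nat_neq_iff)
    then have "measure M0 (\<Union>j<7. good j) = (\<Sum>j<7. measure M0 (good j))"
      using good_sets by (intro finite_measure_finite_Union) (auto simp: M0_def sets_M)
    \<comment> \<open>Seven disjoint events would have total mass at least
      \<open>7 / 6\<close>.\<close>
    moreover have "(\<Sum>j<7::nat. 1 / 6) \<le> (\<Sum>j<7. measure M0 (good j))"
      using prob_good by (intro sum_mono) simp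
    ultimately show False
      using prob_le_1[of "\<Union>j<7. good j"] by simp
  qed
  \<comment> \<open>Rounding loses at most a factor 2, as
    \<open>1 / \<epsilon> < k + 1 \<le> 2 * k\<close>, and \<open>n - 1 \<ge> 2 * n / 3\<close> for
    \<open>n \<ge> 3\<close>.\<close>
  moreover have "1 / (2 * \<epsilon>) * (2 * n / 3) \<le> k * (real n - 1)"
  proof (rule mult_mono)
    have "1 / \<epsilon> \<le> 2 * real k"
      using k_gt \<open>k \<ge> 1\<close> by linarith
    then show "1 / (2 * \<epsilon>) \<le> k"
      by (simp add: field_simps)
  qed (use n in auto)
  ultimately have "1 / (2 * \<epsilon>) * (2 * n / 3) \<le> 2 * \<alpha>"
    by linarith
  then show ?thesis
    using \<epsilon> by (simp add: field_simps)
qed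

text \<open>Both claims follow from comparing the middle entry of the minimum with
  \<open>n / \<epsilon>\<close>. The threshold \<open>T0\<close> is fixed from
  \<open>\<epsilon>\<close> and \<open>\<delta>\<close> alone, before \<open>n\<close>,
  \<open>f\<close>, \<open>M\<close> and \<open>\<alpha>\<close>.\<close>

theorem theorem5:
  "\<exists>c>0. \<forall>(\<epsilon>::real) (\<delta>::nat \<Rightarrow> real).
     0 < \<epsilon> \<and> \<epsilon> < 1 \<and> (\<forall>T. 0 \<le> \<delta> T \<and> \<delta> T < 1) \<longrightarrow>
     (\<exists>T0. \<forall>T\<ge>T0. \<forall>n\<ge>3. \<forall>f\<in>{min_cut n, min_degree n}. \<forall>M \<alpha>.
        continual_mechanism n T M \<and>
        differentially_private n T \<epsilon> (\<delta> T) M \<and>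
        accurate n T \<alpha> f M \<longrightarrow>
        (\<delta> T > 0 \<and> \<delta> \<in> o(\<lambda>T. \<epsilon> / real T) \<longrightarrow>
           \<alpha> \<ge> c * Min {real T powr (1/3) /
                         (\<epsilon> powr (2/3) * ln (\<epsilon> * real T) powr (2/3)),
                       sqrt (real n) / (\<epsilon> * ln (real n)),
                       real T}) \<and>
        (\<delta> T = 0 \<longrightarrow>
           \<alpha> \<ge> c * Min {sqrt (real T / \<epsilon>), real n / \<epsilon>, real T}))"
proof (intro exI[of _ "1 / 6"] conjI allI impI)
  fix \<epsilon> :: real and \<delta> :: "nat \<Rightarrow> real"
  assume "0 < \<epsilon> \<and> \<epsilon> < 1 \<and> (\<forall>T. 0 \<le> \<delta> T \<and> \<delta> T < 1)"
  then have \<epsilon>: "0 < \<epsilon>" "\<epsilon> < 1" and \<delta>: "\<And>T. 0 \<le> \<delta> T"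
    by auto
  have "\<forall>\<^sub>F T in sequentially. \<delta> \<in> o(\<lambda>T. \<epsilon> / real T) \<longrightarrow> \<delta> T \<le> \<epsilon> / 18"
  proof (cases "\<delta> \<in> o(\<lambda>T. \<epsilon> / real T)")
    case True
    then have "\<forall>\<^sub>F T in sequentially. norm (\<delta> T) \<le> 1 / 18 * norm (\<epsilon> / real T)"
      by (rule landau_o.smallD) simp
    with eventually_ge_at_top[of 1] show ?thesis
    proof eventually_elim
      case (elim T)
      then have "\<epsilon> / real T \<le> \<epsilon> / 1"
        using \<epsilon> by (intro divide_left_mono) auto
      moreover have "\<delta> T \<le> 1 / 18 * (\<epsilon> / real T)"
        using elim \<epsilon> \<delta>[of T] by simp
      ultimately show ?case by linarith
    qed
  qed simp
  moreover have "\<forall>\<^sub>F T in sequentially. 7 / \<epsilon> \<le> real T"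
    using filterlim_real_sequentially by (simp add: filterlim_at_top)
  ultimately have "\<forall>\<^sub>F T in sequentially. (\<delta> \<in> o(\<lambda>T. \<epsilon> / real T) \<longrightarrow> \<delta> T \<le> \<epsilon> / 18) \<and> 7 / \<epsilon> \<le> real T"
    by (rule eventually_conj)
  then obtain T0 where T0: "\<And>T. T \<ge> T0 \<Longrightarrow> \<delta> \<in> o(\<lambda>T. \<epsilon> / real T) \<Longrightarrow> \<delta> T \<le> \<epsilon> / 18"
    "\<And>T. T \<ge> T0 \<Longrightarrow> 7 / \<epsilon> \<le> real T"
    unfolding eventually_sequentially by blast
  show "\<exists>T0. \<forall>T\<ge>T0. \<forall>n\<ge>3. \<forall>f\<in>{min_cut n, min_degree n}. \<forall>M \<alpha>.
        continual_mechanism n T M \<and>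
        differentially_private n T \<epsilon> (\<delta> T) M \<and>
        accurate n T \<alpha> f M \<longrightarrow>
        (\<delta> T > 0 \<and> \<delta> \<in> o(\<lambda>T. \<epsilon> / real T) \<longrightarrow>
           \<alpha> \<ge> 1 / 6 * Min {real T powr (1/3) /
                         (\<epsilon> powr (2/3) * ln (\<epsilon> * real T) powr (2/3)),
                       sqrt (real n) / (\<epsilon> * ln (real n)),
                       real T}) \<and>
        (\<delta> T = 0 \<longrightarrow>
           \<alpha> \<ge> 1 / 6 * Min {sqrt (real T / \<epsilon>), real n / \<epsilon>, real T})"
  proof (intro exI[of _ T0] allI ballI impI, elim conjE)
    fix T n f M \<alpha>
    assume T: "T \<ge> T0" and n: "(n::nat) \<ge> 3" and f: "f \<in> {min_cut n, min_degree n}"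
      and M: "continual_mechanism n T M" "differentially_private n T \<epsilon> (\<delta> T) M" "accurate n T \<alpha> f M"
    have bound: "real n / \<epsilon> \<le> 6 * \<alpha>" if "\<delta> T \<le> \<epsilon> / 18"
      using error_lower_bound[OF M n f \<epsilon> \<delta> that T0(2)[OF T]] \<epsilon> by (simp add: field_simps)
    \<comment> \<open>From \<open>n \<ge> 3\<close> the logarithm is at least 1, so replacing it by
      1 only enlarges the quotient.\<close>
    have "exp 1 \<le> real n"
      using exp_le n by linarith
    then have "1 \<le> ln (real n)"
      using n by (subst ln_ge_iff) auto
    moreover have "sqrt (real n) \<le> real n"
      using n by (intro real_le_lsqrt) (auto simp: power2_eq_square)
    ultimately have "sqrt (real n) / (\<epsilon> * ln (real n)) \<le> real n / (\<epsilon> * 1)"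
      using \<epsilon> n by (intro frac_le mult_left_mono) auto
    then have approx: "Min {a, sqrt (real n) / (\<epsilon> * ln (real n)), b} \<le> real n / \<epsilon>" for a b
      by (intro Min.coboundedI[THEN order_trans]) auto
    have sixth: "1 / 6 * m \<le> \<alpha>" if "m \<le> 6 * \<alpha>" for m
      using that by simp
    have pure: "Min {a, real n / \<epsilon>, b} \<le> real n / \<epsilon>" for a b
      by (rule Min.coboundedI) auto
    show "(\<delta> T > 0 \<and> \<delta> \<in> o(\<lambda>T. \<epsilon> / real T) \<longrightarrow>
           \<alpha> \<ge> 1 / 6 * Min {real T powr (1/3) /
                         (\<epsilon> powr (2/3) * ln (\<epsilon> * real T) powr (2/3)),
                       sqrt (real n) / (\<epsilon> * ln (real n)),
                       real T}) \<and>
        (\<delta> T = 0 \<longrightarrow>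
           \<alpha> \<ge> 1 / 6 * Min {sqrt (real T / \<epsilon>), real n / \<epsilon>, real T})"
    proof (intro conjI impI)
      assume "\<delta> T > 0 \<and> \<delta> \<in> o(\<lambda>T. \<epsilon> / real T)"
      then have "real n / \<epsilon> \<le> 6 * \<alpha>"
        using bound T0(1)[OF T] by blast
      from order_trans[OF approx this] show "\<alpha> \<ge> 1 / 6 * Min {real T powr (1/3) /
                         (\<epsilon> powr (2/3) * ln (\<epsilon> * real T) powr (2/3)),
                       sqrt (real n) / (\<epsilon> * ln (real n)),
                       real T}"
        by (rule sixth)
    next
      assume "\<delta> T = 0"
      then have "real n / \<epsilon> \<le> 6 * \<alpha>"
        using bound \<epsilon> by simp
      from order_trans[OF pure this] show "\<alpha> \<ge> 1 / 6 * Min {sqrt (real T / \<epsilon>), real n / \<epsilon>, real T}"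
        by (rule sixth)
    qed
  qed
qed simp

end
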